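(* Let $(\Delta_{m-1},C)$ be a spectral duality structure with response dimension $r$, and let $$L=\{x\in\mathbb R^m:\ \kappa(z)^{1/4}x_z=\kappa(\sigma(z))^{1/4}x_{\sigma(z)}\ \text{for every orbit }\{z,\sigma(z)\}\}.$$ Then $\dim L=m-r$ and $$\Phi(\Sigma^\circ)=L\cap S^{m-1}_+(2).$$ In particular $\Phi(\Sigma^\circ)$ is an open piece of a great subsphere of dimension $m-r-1$; hence $\Sigma^\circ$ is a totally geodesic submanifold of $(\Delta^\circ_{m-1},g^{\mathrm{FR}})$, of codimension exactly $r$.
   Context: Let $m\ge2$ and let $Z=\{z_1,\dots,z_m\}$ be a set of $m$ distinct sites; coordinates of $\mathbb R^m$ are indexed by $Z$. $\Delta_{m-1}=\{\pi\in\mathbb R^m:\pi_z\ge0,\ \sum_z\pi_z=1\}$, with relative interior $\Delta_{m-1}^\circ$ (all $\pi_z>0$). A spectral duality structure is a pair $(\Delta_{m-1},C)$, with $C:\Delta_{m-1}\times(0,1)\to\mathbb R$ smooth, admitting a spectral representation, i.e. data such that: (S1) for each $\gamma\in(0,1)$, $\pi\mapsto C(\pi,\gamma)$ is $\mathcal C^1$ on $\Delta^\circ_{m-1}$ and extends continuously to the boundary; (S2) $C(\pi,\gamma)=\sum_z\pi_zu(z;\gamma)/\sum_z\pi_zs(z;\gamma)$ with denominator strictly positive on $\Delta_{m-1}\times(0,1)$, where $u(z;\gamma)=\sum_{\nu=1}^Nf_\nu(\gamma)A_\nu(z)$, $s(z;\gamma)=\sum_{\nu=1}^Nf_\nu(\gamma)(A_\nu(z)+B_\nu(z))$,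 the $f_\nu$ are real-analytic and linearly independent on $(0,1)$, and the matrix $(A_\nu(z_i))\in\mathbb R^{N\times m}$ has full column rank $m\le N$; (S3) there are an involution $\sigma$ of $Z$ with at least one non-trivial pair, and weights $\kappa(z)>0$ independent of $\nu$, with $B_\nu(z)=\kappa(z)A_\nu(\sigma(z))$ for all $\nu,z$; (S4) there is $K>0$ with $\kappa(z)\kappa(\sigma(z))=K$ for all $z$. An orbit is a pair $\{z,\sigma(z)\}$ with $\sigma(z)\neq z$. Put $C^\ast=1/(1+\sqrt K)$, $\psi_z(\gamma)=u(z;\gamma)-C^\ast s(z;\gamma)$, $V=\operatorname{span}\{\psi(\gamma):\gamma\in(0,1)\}\subseteq\mathbb R^m$, $r=\dim V$ (the response dimension). The separatrix is $\Sigma=\{\pi\in\Delta_{m-1}: C(\pi,\gamma)\text{ is constant in }\gamma\}$, and $\Sigma^\circ=\Sigma\cap\Delta^\circ_{m-1}$. The Fisher–Rao metric on $\Delta^\circ_{m-1}$ is $g^{\mathrm{FR}}_\pi(h,k)=\sum_z h_zk_z/\pi_z$ for $h,k$ with coordinate sum $0$. $\Phi(\pi)=2\sqrt\pi$ (componentwise), and $S^{m-1}_+(2)=\{x\in\mathbb R^m:\sum_zx_z^2=4,\ x_z>0\ \forall z\}$ with the round metric. *)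

theory Defs
  imports "HOL-Analysis.Analysis"
begin

section \<open>Smooth and real-analytic functions\<close>

text \<open>On an open subset of a Euclidean space this is the usual class of k times continuously
  differentiable functions, described through iterated directional derivatives.\<close>

primrec Ck_on :: "nat \<Rightarrow> 'a::euclidean_space set \<Rightarrow> ('a \<Rightarrow> 'b::real_normed_vector) \<Rightarrow> bool" where
  "Ck_on 0 U f \<longleftrightarrow> continuous_on U f"
| "Ck_on (Suc k) U f \<longleftrightarrow>
     (\<forall>x\<in>U. f differentiable (at x)) \<and> (\<forall>v. Ck_on k U (\<lambda>x. frechet_derivative f (at x) v))"

definition smooth_on :: "'a::euclidean_space set \<Rightarrow> ('a \<Rightarrow> 'b::real_normed_vector) \<Rightarrow> bool" where
  "smooth_on U f \<longleftrightarrow> (\<forall>k. Ck_on k U f)"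

text \<open>Regularity on a set that is not open in the ambient space (a simplex, its relative
  interior) means existence of an extension of that regularity to an open neighbourhood.\<close>

definition C1_on_subset :: "'a::euclidean_space set \<Rightarrow> ('a \<Rightarrow> 'b::real_normed_vector) \<Rightarrow> bool" where
  "C1_on_subset S f \<longleftrightarrow>
     (\<exists>U F. open U \<and> S \<subseteq> U \<and> Ck_on 1 U F \<and> (\<forall>x\<in>S. F x = f x))"

definition smooth_on_subset :: "'a::euclidean_space set \<Rightarrow> ('a \<Rightarrow> 'b::real_normed_vector) \<Rightarrow> bool" where
  "smooth_on_subset S f \<longleftrightarrow>
     (\<exists>U F. open U \<and> S \<subseteq> U \<and> smooth_on U F \<and> (\<forall>x\<in>S. F x = f x))"

definition real_analytic_on :: "real set \<Rightarrow> (real \<Rightarrow> real) \<Rightarrow> bool" where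
  "real_analytic_on S f \<longleftrightarrow> (\<forall>x\<in>S. \<exists>F. (\<lambda>h. f (x + h)) has_fps_expansion F)"


section \<open>Spectral duality structures\<close>

text \<open>The set of sites is a finite type \<open>'z\<close>; the index \<open>\<nu>\<close> of the spectral functions ranges over
  a finite type \<open>'n\<close>, whose cardinality is the number N of spectral functions.\<close>

definition prob_simplex :: "(real ^ 'z::finite) set" where
  "prob_simplex = {\<pi>. (\<forall>z. 0 \<le> \<pi> $ z) \<and> (\<Sum>z\<in>UNIV. \<pi> $ z) = 1}"

definition open_simplex :: "(real ^ 'z::finite) set" where
  "open_simplex = {\<pi> \<in> prob_simplex. \<forall>z. 0 < \<pi> $ z}"

definition u_spec :: "('n::finite \<Rightarrow> real \<Rightarrow> real) \<Rightarrow> real ^ 'z::finite ^ 'n \<Rightarrow> 'z \<Rightarrow> real \<Rightarrow> real" where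
  "u_spec f A z \<gamma> = (\<Sum>\<nu>\<in>UNIV. f \<nu> \<gamma> * A $ \<nu> $ z)"

definition s_spec ::
    "('n::finite \<Rightarrow> real \<Rightarrow> real) \<Rightarrow> real ^ 'z::finite ^ 'n \<Rightarrow> real ^ 'z ^ 'n \<Rightarrow> 'z \<Rightarrow> real \<Rightarrow> real" where
  "s_spec f A B z \<gamma> = (\<Sum>\<nu>\<in>UNIV. f \<nu> \<gamma> * (A $ \<nu> $ z + B $ \<nu> $ z))"

text \<open>The assumption \<open>continuous\<close> renders continuous extension to the boundary: C is
  given on the closed simplex, so the extension is C itself.\<close>

locale spectral_duality_structure =
  fixes C :: "real ^ 'z::finite \<Rightarrow> real \<Rightarrow> real"
    and f :: "'n::finite \<Rightarrow> real \<Rightarrow> real"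
    and A B :: "real ^ 'z ^ 'n"
    and \<sigma> :: "'z \<Rightarrow> 'z"
    and \<kappa> :: "'z \<Rightarrow> real"
    and K :: real
  assumes sites: "CARD('z) \<ge> 2"
    and smooth: "smooth_on_subset (prob_simplex \<times> {0<..<1}) (\<lambda>(\<pi>, \<gamma>). C \<pi> \<gamma>)"
    and C1: "\<And>\<gamma>. \<gamma> \<in> {0<..<1} \<Longrightarrow> C1_on_subset open_simplex (\<lambda>\<pi>. C \<pi> \<gamma>)"
    and continuous: "\<And>\<gamma>. \<gamma> \<in> {0<..<1} \<Longrightarrow> continuous_on prob_simplex (\<lambda>\<pi>. C \<pi> \<gamma>)"
    and denominator_pos: "\<And>\<pi> \<gamma>. \<pi> \<in> prob_simplex \<Longrightarrow> \<gamma> \<in> {0<..<1} \<Longrightarrow>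
          0 < (\<Sum>z\<in>UNIV. \<pi> $ z * s_spec f A B z \<gamma>)"
    and representation: "\<And>\<pi> \<gamma>. \<pi> \<in> prob_simplex \<Longrightarrow> \<gamma> \<in> {0<..<1} \<Longrightarrow>
          C \<pi> \<gamma> = (\<Sum>z\<in>UNIV. \<pi> $ z * u_spec f A z \<gamma>) / (\<Sum>z\<in>UNIV. \<pi> $ z * s_spec f A B z \<gamma>)"
    and analytic: "\<And>\<nu>. real_analytic_on {0<..<1} (f \<nu>)"
    and lin_indep: "\<And>c. (\<forall>\<gamma>\<in>{0<..<1}. (\<Sum>\<nu>\<in>UNIV. c \<nu> * f \<nu> \<gamma>) = 0) \<Longrightarrow> (\<forall>\<nu>. c \<nu> = 0)"
    and full_column_rank: "rank A = CARD('z)"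
    and columns_le_rows: "CARD('z) \<le> CARD('n)"
    and involution: "\<And>z. \<sigma> (\<sigma> z) = z"
    and nontrivial_pair: "\<exists>z. \<sigma> z \<noteq> z"
    and weight_pos: "\<And>z. 0 < \<kappa> z"
    and duality: "\<And>\<nu> z. B $ \<nu> $ z = \<kappa> z * A $ \<nu> $ \<sigma> z"
    and K_pos: "0 < K"
    and weight_product: "\<And>z. \<kappa> z * \<kappa> (\<sigma> z) = K"

definition C_star :: "real \<Rightarrow> real" where
  "C_star K = 1 / (1 + sqrt K)"

definition psi ::
    "('n::finite \<Rightarrow> real \<Rightarrow> real) \<Rightarrow> real ^ 'z::finite ^ 'n \<Rightarrow> real ^ 'z ^ 'n \<Rightarrow> real \<Rightarrow> real \<Rightarrow> real ^ 'z" where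
  "psi f A B K \<gamma> = (\<chi> z. u_spec f A z \<gamma> - C_star K * s_spec f A B z \<gamma>)"

definition response_dim ::
    "('n::finite \<Rightarrow> real \<Rightarrow> real) \<Rightarrow> real ^ 'z::finite ^ 'n \<Rightarrow> real ^ 'z ^ 'n \<Rightarrow> real \<Rightarrow> nat" where
  "response_dim f A B K = dim (span (psi f A B K ` {0<..<1}))"

definition separatrix :: "(real ^ 'z::finite \<Rightarrow> real \<Rightarrow> real) \<Rightarrow> (real ^ 'z) set" where
  "separatrix C = {\<pi> \<in> prob_simplex. C \<pi> constant_on {0<..<1}}"

definition open_separatrix :: "(real ^ 'z::finite \<Rightarrow> real \<Rightarrow> real) \<Rightarrow> (real ^ 'z) set" where
  "open_separatrix C = separatrix C \<inter> open_simplex"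

definition L_space :: "('z::finite \<Rightarrow> 'z) \<Rightarrow> ('z \<Rightarrow> real) \<Rightarrow> (real ^ 'z) set" where
  "L_space \<sigma> \<kappa> =
     {x. \<forall>z. \<sigma> z \<noteq> z \<longrightarrow> \<kappa> z powr (1/4) * x $ z = \<kappa> (\<sigma> z) powr (1/4) * x $ \<sigma> z}"

definition \<Phi> :: "real ^ 'z::finite \<Rightarrow> real ^ 'z" where
  "\<Phi> \<pi> = (\<chi> z. 2 * sqrt (\<pi> $ z))"

definition pos_sphere :: "(real ^ 'z::finite) set" where
  "pos_sphere = {x. (\<Sum>z\<in>UNIV. (x $ z)\<^sup>2) = 4 \<and> (\<forall>z. 0 < x $ z)}"

definition great_subsphere :: "nat \<Rightarrow> (real ^ 'z::finite) set \<Rightarrow> bool" where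
  "great_subsphere k G \<longleftrightarrow> (\<exists>W. subspace W \<and> dim W = k + 1 \<and> G = W \<inter> sphere 0 2)"


section \<open>Submanifolds of Euclidean space\<close>

definition embedded_submanifold :: "nat \<Rightarrow> 'a::euclidean_space set \<Rightarrow> bool" where
  "embedded_submanifold k S \<longleftrightarrow>
     (\<forall>p\<in>S. \<exists>U V (\<phi> :: 'a \<Rightarrow> 'a) \<phi>' W.
        open U \<and> p \<in> U \<and> open V \<and> homeomorphism U V \<phi> \<phi>' \<and> smooth_on U \<phi> \<and> smooth_on V \<phi>' \<and>
        subspace W \<and> dim W = k \<and> \<phi> ` (S \<inter> U) = W \<inter> V)"

definition tangent_space :: "'a::euclidean_space set \<Rightarrow> 'a \<Rightarrow> 'a set" where
  "tangent_space S p =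
     {v. \<exists>c. c 0 = p \<and> (\<exists>\<epsilon>>0. \<forall>t. \<bar>t\<bar> < \<epsilon> \<longrightarrow> c t \<in> S) \<and> (c has_vector_derivative v) (at 0)}"


section \<open>Riemannian metrics on open subsets of affine subspaces\<close>

text \<open>Let M be relatively open in its affine hull, with a Riemannian metric g. The
  difference vectors of the hull form constant, hence commuting, vector fields on M, and on these
  the Koszul formula expresses the Levi-Civita connection as
  \<open>g (\<nabla>\<^sub>a b) w = (\<partial>\<^sub>a g(b,w) + \<partial>\<^sub>b g(a,w) - \<partial>\<^sub>w g(a,b)) / 2\<close> (Christoffel symbols of the first kind).
  The derivatives are taken along lines in M only, so they do not depend on g off M.\<close>

definition metric_deriv :: "('a::euclidean_space \<Rightarrow> 'a \<Rightarrow> 'a \<Rightarrow> real) \<Rightarrow> 'a \<Rightarrow> 'a \<Rightarrow> 'a \<Rightarrow> 'a \<Rightarrow> real" where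
  "metric_deriv g p v a b = deriv (\<lambda>t. g (p + t *\<^sub>R v) a b) 0"

definition christoffel :: "('a::euclidean_space \<Rightarrow> 'a \<Rightarrow> 'a \<Rightarrow> real) \<Rightarrow> 'a \<Rightarrow> 'a \<Rightarrow> 'a \<Rightarrow> 'a \<Rightarrow> real" where
  "christoffel g p a b w =
     (metric_deriv g p a b w + metric_deriv g p b a w - metric_deriv g p w a b) / 2"

text \<open>The geodesic equation \<open>\<nabla>\<^bsub>c'\<^esub> c' = 0\<close>, tested against all tangent vectors. Twice
  differentiable solutions are automatically smooth.\<close>

definition geodesic_on ::
    "'a::euclidean_space set \<Rightarrow> ('a \<Rightarrow> 'a \<Rightarrow> 'a \<Rightarrow> real) \<Rightarrow> real set \<Rightarrow> (real \<Rightarrow> 'a) \<Rightarrow> bool" where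
  "geodesic_on M g I c \<longleftrightarrow>
     open I \<and> is_interval I \<and> c ` I \<subseteq> M \<and>
     (\<exists>c' c''. \<forall>t\<in>I.
        (c has_vector_derivative c' t) (at t) \<and> (c' has_vector_derivative c'' t) (at t) \<and>
        (\<forall>w\<in>tangent_space M (c t). g (c t) (c'' t) w + christoffel g (c t) (c' t) (c' t) w = 0))"

text \<open>As geodesics of M exist in every tangent direction, the last condition is equivalent to
  the vanishing of the second fundamental form of S in (M,g). It does not force S to be closed in M
  or geodesics to stay in S for all times.\<close>

definition totally_geodesic_submanifold ::
    "'a::euclidean_space set \<Rightarrow> ('a \<Rightarrow> 'a \<Rightarrow> 'a \<Rightarrow> real) \<Rightarrow> nat \<Rightarrow> 'a set \<Rightarrow> bool" where
  "totally_geodesic_submanifold M g k S \<longleftrightarrow>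
     openin (top_of_set (affine hull M)) M \<and> embedded_submanifold k S \<and> S \<subseteq> M \<and>
     (\<forall>I c t0. geodesic_on M g I c \<and> t0 \<in> I \<and> c t0 \<in> S \<and>
         vector_derivative c (at t0) \<in> tangent_space S (c t0) \<longrightarrow>
       (\<exists>\<epsilon>>0. \<forall>t\<in>I. \<bar>t - t0\<bar> < \<epsilon> \<longrightarrow> c t \<in> S))"

definition fisher_rao :: "real ^ 'z::finite \<Rightarrow> real ^ 'z \<Rightarrow> real ^ 'z \<Rightarrow> real" where
  "fisher_rao \<pi> h k = (\<Sum>z\<in>UNIV. h $ z * k $ z / \<pi> $ z)"

end

theory Submission
  imports Defs
begin

text \<open>Because the functions \<open>u z\<close> are linearly independent, \<open>C \<pi>\<close> equals a constant \<open>c\<close> if and only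
  if \<open>(1 - c) * \<pi> $ z = c * \<kappa> (\<sigma> z) * \<pi> $ \<sigma> z\<close> for all z. Applying this relation
  twice forces \<open>c = C_star K\<close> when \<open>\<pi>\<close> is positive, and then the relation says that \<open>\<pi>\<close> is
  orthogonal to all response vectors \<open>psi \<gamma>\<close>. Hence the open separatrix is the slice of the open
  simplex by a subspace of dimension m - r, and taking square roots turns this subspace into L.
  For a Fisher--Rao geodesic c, the curve \<open>x = sqrt c\<close> solves \<open>x'' = - e x\<close> with a constant
  \<open>e \<ge> 0\<close>, so a linear form that vanishes on x and on x' at one time vanishes on x at all times.\<close>

section \<open>Affine slices of open sets\<close>

lemma Ck_on_const: "Ck_on k U (\<lambda>x. c)"
  by (induction k arbitrary: c) auto

text \<open>The derivative is the identity at every point, so each directional derivative is a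
  constant function.\<close>

lemma smooth_on_translation: "smooth_on U (\<lambda>x. x + a)"
proof -
  have D: "((\<lambda>x. x + a) has_derivative (\<lambda>h. h)) (at x)" for x
    by (auto intro!: derivative_eq_intros)
  have "Ck_on k U (\<lambda>x. x + a)" for k
  proof (cases k)
    case (Suc j)
    have "frechet_derivative (\<lambda>x. x + a) (at x) = (\<lambda>h. h)" for x
      using frechet_derivative_at[OF D] by simp
    then show ?thesis
      using D by (auto simp: Suc Ck_on_const differentiable_def)
  qed (auto intro!: continuous_intros)
  then show ?thesis by (simp add: smooth_on_def)
qed

text \<open>Translation by \<open>- p\<close> is a flattening chart on all of \<open>U\<close>: by
  \<open>slice\<close> it carries \<open>S\<close> onto the part of \<open>W\<close> inside the
  translated open set.\<close>

lemma embedded_submanifold_affine_slice: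
  fixes W :: "'a::euclidean_space set"
  assumes W: "subspace W" and U: "open U" "S \<subseteq> U"
    and slice: "\<And>p x. p \<in> S \<Longrightarrow> x \<in> U \<Longrightarrow> x \<in> S \<longleftrightarrow> x - p \<in> W"
  shows "embedded_submanifold (dim W) S"
  unfolding embedded_submanifold_def
proof
  fix p assume p: "p \<in> S"
  let ?\<phi> = "\<lambda>x. x + (- p)" and ?\<psi> = "\<lambda>x. x + p"
  have V: "open (?\<phi> ` U)"
    using open_translation_subtract[OF U(1), of p] by simp
  have h: "homeomorphism U (?\<phi> ` U) ?\<phi> ?\<psi>"
    by (auto simp: homeomorphism_def image_image intro!: continuous_intros)
  have eq: "?\<phi> ` (S \<inter> U) = W \<inter> ?\<phi> ` U"
    using slice[OF p] U(2) by auto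
  show "\<exists>U V (\<phi> :: 'a \<Rightarrow> 'a) \<phi>' W'. open U \<and> p \<in> U \<and> open V \<and> homeomorphism U V \<phi> \<phi>' \<and>
      smooth_on U \<phi> \<and> smooth_on V \<phi>' \<and> subspace W' \<and> dim W' = dim W \<and> \<phi> ` (S \<inter> U) = W' \<inter> V"
    using p U(2)
    by (intro exI[of _ U] exI[of _ "?\<phi> ` U"] exI[of _ ?\<phi>] exI[of _ ?\<psi>] exI[of _ W] conjI
        V h eq U(1) W smooth_on_translation refl) blast
qed

text \<open>Projecting along \<open>p\<close> splits \<open>W\<close> into the line through
  \<open>p\<close> and the hyperplane section. It is applied with \<open>a = 1\<close>, the
  coordinate sum.\<close>

lemma dim_subspace_Int_hyperplane:
  fixes W :: "'a::euclidean_space set"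
  assumes W: "subspace W" and p: "p \<in> W" "a \<bullet> p \<noteq> 0"
  shows "dim {x \<in> W. a \<bullet> x = 0} + 1 = dim W"
proof -
  let ?H = "{x \<in> W. a \<bullet> x = 0}"
  have H: "subspace ?H"
    using W by (auto simp: subspace_def inner_add_right)
  have "W \<subseteq> span (insert p ?H)"
  proof
    fix x assume x: "x \<in> W"
    let ?k = "(a \<bullet> x) / (a \<bullet> p)"
    have "x - ?k *\<^sub>R p \<in> ?H"
      using x p W by (auto simp: subspace_diff subspace_scale inner_diff_right)
    then show "x \<in> span (insert p ?H)"
      unfolding span_insert by (auto intro: span_base)
  qed
  moreover have "span (insert p ?H) \<subseteq> W"
    using p W by (intro span_minimal) auto
  ultimately have "dim W = dim (insert p ?H)"
    by (metis dim_span subset_antisym)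
  also have "\<dots> = dim ?H + 1"
    using p H by (simp add: dim_insert span_eq_iff[THEN iffD2])
  finally show ?thesis by simp
qed

section \<open>The Fisher--Rao geometry of the open simplex\<close>

lemma inner_one_vec: "(1 :: real ^ 'z::finite) \<bullet> x = (\<Sum>z\<in>UNIV. x $ z)"
  by (simp add: inner_vec_def)

text \<open>This open set cuts the open simplex and the open separatrix out of affine subspaces, and
  the positive sphere out of the full sphere.\<close>

lemma open_positive_orthant: "open {x :: real ^ 'z::finite. \<forall>z. 0 < x $ z}"
proof -
  have "{x :: real ^ 'z. \<forall>z. 0 < x $ z} = (\<Inter>z. {x. 0 < x $ z})" by auto
  then show ?thesis
    by (auto intro!: open_INT open_Collect_less continuous_intros)
qed

lemma open_simplex_iff: "x \<in> open_simplex \<longleftrightarrow> (\<forall>z. 0 < x $ z) \<and> 1 \<bullet> x = 1"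
  by (auto simp: open_simplex_def prob_simplex_def inner_one_vec less_imp_le)

lemma embedded_submanifold_open_simplex:
  "embedded_submanifold (CARD('z) - 1) (open_simplex :: (real ^ 'z::finite) set)"
proof -
  have "embedded_submanifold (dim {x :: real ^ 'z. 1 \<bullet> x = 0}) (open_simplex :: (real ^ 'z) set)"
    by (rule embedded_submanifold_affine_slice[OF subspace_hyperplane open_positive_orthant])
      (auto simp: open_simplex_iff inner_diff_right)
  then show ?thesis by (simp add: dim_hyperplane)
qed

lemma openin_affine_hull_open_simplex:
  "openin (top_of_set (affine hull open_simplex)) (open_simplex :: (real ^ 'z::finite) set)"
proof -
  have "affine hull open_simplex \<subseteq> {x :: real ^ 'z. 1 \<bullet> x = 1}"
    by (intro hull_minimal affine_hyperplane) (auto simp: open_simplex_iff)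
  then have "open_simplex = affine hull open_simplex \<inter> {x :: real ^ 'z. \<forall>z. 0 < x $ z}"
    using hull_subset[of "open_simplex :: (real ^ 'z) set" affine] by (auto simp: open_simplex_iff)
  then show ?thesis
    using open_positive_orthant openin_open by blast
qed

text \<open>The straight line through \<open>p\<close> in direction \<open>w\<close> stays positive
  for short times. This supplies enough test vectors for the geodesic equation.\<close>

lemma tangent_space_open_simplex:
  fixes p :: "real ^ 'z::finite"
  assumes p: "p \<in> open_simplex" and w: "1 \<bullet> w = 0"
  shows "w \<in> tangent_space open_simplex p"
proof -
  let ?T = "(\<lambda>t. p + t *\<^sub>R w) -` {x. \<forall>z. 0 < x $ z}"
  have "open ?T"
    by (intro open_vimage open_positive_orthant continuous_intros)
  moreover have "0 \<in> ?T" using p by (simp add: open_simplex_iff)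
  ultimately obtain \<epsilon> where \<epsilon>: "\<epsilon> > 0" "ball 0 \<epsilon> \<subseteq> ?T"
    by (meson open_contains_ball)
  have "p + t *\<^sub>R w \<in> open_simplex" if "\<bar>t\<bar> < \<epsilon>" for t
    using \<epsilon>(2) that p w by (auto simp: open_simplex_iff inner_add_right subset_iff)
  moreover have "((\<lambda>t. p + t *\<^sub>R w) has_vector_derivative w) (at 0)"
    by (auto intro!: derivative_eq_intros)
  ultimately show ?thesis
    unfolding tangent_space_def using \<epsilon>(1)
    by (intro CollectI exI[of _ "\<lambda>t. p + t *\<^sub>R w"]) auto
qed

section \<open>Christoffel symbols and geodesics in square-root coordinates\<close>

lemma metric_deriv_fisher_rao:
  fixes p :: "real ^ 'z::finite"
  assumes "\<And>z. 0 < p $ z"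
  shows "metric_deriv fisher_rao p v a b = - (\<Sum>z\<in>UNIV. a $ z * b $ z * v $ z / (p $ z)\<^sup>2)"
proof -
  have "((\<lambda>t. a $ z * b $ z / (p $ z + t * v $ z)) has_real_derivative
      - (a $ z * b $ z * v $ z / (p $ z)\<^sup>2)) (at 0)" for z
    using assms[of z]
    by (auto intro!: derivative_eq_intros simp: power2_eq_square)
  then have "((\<lambda>t. \<Sum>z\<in>UNIV. a $ z * b $ z / (p $ z + t * v $ z)) has_real_derivative
      (\<Sum>z\<in>UNIV. - (a $ z * b $ z * v $ z / (p $ z)\<^sup>2))) (at 0)"
    by (intro DERIV_sum) auto
  then show ?thesis
    unfolding metric_deriv_def fisher_rao_def
    by (simp add: DERIV_imp_deriv sum_negf)
qed

text \<open>The metric is diagonal, so the three derivatives in the Koszul formula are one and the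
  same symmetric expression, and two of them cancel.\<close>

lemma christoffel_fisher_rao:
  fixes p :: "real ^ 'z::finite"
  assumes "\<And>z. 0 < p $ z"
  shows "christoffel fisher_rao p a b w = - (\<Sum>z\<in>UNIV. a $ z * b $ z * w $ z / (p $ z)\<^sup>2) / 2"
  unfolding christoffel_def metric_deriv_fisher_rao[OF assms]
  by (simp add: mult.commute mult.left_commute)

text \<open>Differences of two basis vectors serve as test vectors. The common value of the
  components is the Lagrange multiplier of a geodesic.\<close>

lemma components_eq_if_orthogonal_to_hyperplane:
  fixes q :: "real ^ 'z::finite"
  assumes "\<And>w. 1 \<bullet> w = 0 \<Longrightarrow> q \<bullet> w = 0"
  shows "q $ i = q $ j"
  using assms[of "axis i 1 - axis j 1"] by (simp add: inner_diff_right inner_axis)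

lemma has_real_derivative_vec_nth:
  assumes "(c has_vector_derivative d) (at t)"
  shows "((\<lambda>t. c t $ z) has_real_derivative d $ z) (at t)"
  using bounded_linear.has_vector_derivative[OF bounded_linear_vec_nth assms]
  by (simp add: has_real_derivative_iff_has_vector_derivative)

text \<open>Used to differentiate identities that hold along a curve on an open set of
  times.\<close>

lemma DERIV_locally_constant:
  fixes h :: "real \<Rightarrow> real"
  assumes "(h has_real_derivative d) (at t)" "open I" "t \<in> I" "\<And>s. s \<in> I \<Longrightarrow> h s = k"
  shows "d = 0"
proof -
  have "((\<lambda>_. k) has_real_derivative d) (at t)"
    using has_field_derivative_transform_within_open[OF assms(1-3)] assms(4) by auto
  then show ?thesis by (metis DERIV_const DERIV_unique)
qed

text \<open>The multiplier of the geodesic equation for the constraint \<open>1 \<bullet> c t = 1\<close> turns out to be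
  minus the kinetic energy of \<open>sqrt c\<close> (up to a factor), which is conserved.\<close>

lemma fisher_rao_geodesic_sqrt:
  fixes c :: "real \<Rightarrow> real ^ 'z::finite"
  assumes geo: "geodesic_on open_simplex fisher_rao I c"
  obtains e where "e \<ge> 0"
    "\<And>t z. t \<in> I \<Longrightarrow> ((\<lambda>t. sqrt (c t $ z)) has_real_derivative
        vector_derivative c (at t) $ z / (2 * sqrt (c t $ z))) (at t)"
    "\<And>t z. t \<in> I \<Longrightarrow> ((\<lambda>t. vector_derivative c (at t) $ z / (2 * sqrt (c t $ z)))
        has_real_derivative - e * sqrt (c t $ z)) (at t)"
proof -
  obtain c' c'' where I: "open I" "is_interval I" and cI: "c ` I \<subseteq> open_simplex"
    and D1: "\<And>t. t \<in> I \<Longrightarrow> (c has_vector_derivative c' t) (at t)"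
    and D2: "\<And>t. t \<in> I \<Longrightarrow> (c' has_vector_derivative c'' t) (at t)"
    and eq: "\<And>t w. t \<in> I \<Longrightarrow> w \<in> tangent_space open_simplex (c t) \<Longrightarrow>
        fisher_rao (c t) (c'' t) w + christoffel fisher_rao (c t) (c' t) (c' t) w = 0"
    using geo unfolding geodesic_on_def by blast
  have pos: "0 < c t $ z" and sum1: "(\<Sum>z\<in>UNIV. c t $ z) = 1" if "t \<in> I" for t z
    using cI that by (auto simp: open_simplex_iff inner_one_vec)
  \<comment> \<open>The geodesic equation tested against \<open>w\<close> reads
    \<open>q t \<bullet> w = 0\<close>; the factor 2 in the denominator is the one in the
    Christoffel symbol.\<close>
  define q where "q t = (\<chi> z. c'' t $ z / c t $ z - (c' t $ z)\<^sup>2 / (2 * (c t $ z)\<^sup>2))" for t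
  have q_eq: "q t $ i = q t $ j" if t: "t \<in> I" for t i j
  proof (rule components_eq_if_orthogonal_to_hyperplane)
    fix w :: "real ^ 'z" assume "1 \<bullet> w = 0"
    then have "w \<in> tangent_space open_simplex (c t)"
      using tangent_space_open_simplex cI t by blast
    from eq[OF t this] have "(\<Sum>z\<in>UNIV. c'' t $ z * w $ z / c t $ z)
        - (\<Sum>z\<in>UNIV. c' t $ z * c' t $ z * w $ z / (c t $ z)\<^sup>2) / 2 = 0"
      unfolding christoffel_fisher_rao[OF pos[OF t]] fisher_rao_def by simp
    moreover have "q t $ z * w $ z = c'' t $ z * w $ z / c t $ z
        - c' t $ z * c' t $ z * w $ z / (c t $ z)\<^sup>2 / 2" for z
      by (simp add: q_def left_diff_distrib power2_eq_square)
    ultimately show "q t \<bullet> w = 0"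
      by (simp add: inner_vec_def sum_subtractf sum_divide_distrib)
  qed
  \<comment> \<open>The Lagrange multiplier. Any site may be chosen, since for t in \<open>I\<close>
    all components of \<open>q t\<close> agree.\<close>
  define l where "l t = q t $ undefined" for t
  have l: "q t $ z = l t" if "t \<in> I" for t z
    unfolding l_def using that by (rule q_eq)
  have sum_c': "(\<Sum>z\<in>UNIV. c' t $ z) = 0" if t: "t \<in> I" for t
    by (rule DERIV_locally_constant[OF _ I(1) t sum1])
      (auto intro!: DERIV_sum has_real_derivative_vec_nth D1 t)
  have sum_c'': "(\<Sum>z\<in>UNIV. c'' t $ z) = 0" if t: "t \<in> I" for t
    by (rule DERIV_locally_constant[OF _ I(1) t sum_c'])
      (auto intro!: DERIV_sum has_real_derivative_vec_nth D2 t)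
  define v where "v t z = c' t $ z / (2 * sqrt (c t $ z))" for t z
  have Dx: "((\<lambda>t. sqrt (c t $ z)) has_real_derivative v t z) (at t)" if t: "t \<in> I" for t z
    unfolding v_def using pos[OF t, of z]
    by (auto intro!: derivative_eq_intros has_real_derivative_vec_nth[OF D1[OF t]]
        simp: field_simps)
  \<comment> \<open>The second derivative of \<open>sqrt (c t $ z)\<close> is
    \<open>q t $ z / 2 * sqrt (c t $ z)\<close>, and the multiplier \<open>l t\<close> replaces
    \<open>q t $ z\<close>.\<close>
  have Dv: "((\<lambda>t. v t z) has_real_derivative l t / 2 * sqrt (c t $ z)) (at t)" if t: "t \<in> I" for t z
  proof -
    have s: "sqrt (c t $ z) \<noteq> 0" "c t $ z = sqrt (c t $ z) * sqrt (c t $ z)"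
      using pos[OF t, of z] by simp_all
    have "((\<lambda>t. v t z) has_real_derivative
        (c'' t $ z * (2 * sqrt (c t $ z)) - c' t $ z * (2 * v t z))
          / ((2 * sqrt (c t $ z)) * (2 * sqrt (c t $ z)))) (at t)"
      unfolding v_def[of _ z, abs_def]
      by (rule DERIV_divide[OF has_real_derivative_vec_nth[OF D2[OF t]] DERIV_cmult[OF Dx[OF t]],
            unfolded v_def]) (use s in auto)
    moreover have "(c'' t $ z * (2 * sqrt (c t $ z)) - c' t $ z * (2 * v t z))
          / ((2 * sqrt (c t $ z)) * (2 * sqrt (c t $ z))) = l t / 2 * sqrt (c t $ z)"
    proof -
      have "l t = c'' t $ z / c t $ z - (c' t $ z)\<^sup>2 / (2 * (c t $ z)\<^sup>2)"
        using l[OF t, of z] by (simp add: q_def)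
      \<comment> \<open>Writing everything in terms of the root leaves a rational identity in
        \<open>x\<close>.\<close>
      moreover define x where "x = sqrt (c t $ z)"
      ultimately have "l t = c'' t $ z / (x * x) - (c' t $ z)\<^sup>2 / (2 * (x * x)\<^sup>2)"
        using s(2) by simp
      moreover have "x \<noteq> 0" using s x_def by simp
      ultimately show ?thesis
        unfolding v_def x_def[symmetric]
        by (simp add: field_simps power2_eq_square)
    qed
    ultimately show ?thesis by (rule DERIV_cong)
  qed
  \<comment> \<open>Multiply the equation \<open>q t $ z = l t\<close> by \<open>c t $ z\<close> and
    sum over z: the sum of \<open>c''\<close> is 0 and the sum of \<open>c\<close> is 1.\<close>
  have l_eq: "l t / 2 = - (\<Sum>z\<in>UNIV. (v t z)\<^sup>2)" if t: "t \<in> I" for t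
  proof -
    have "c'' t $ z = l t * c t $ z + 2 * (v t z)\<^sup>2" for z
      using l[OF t, of z] pos[OF t, of z]
      by (simp add: q_def v_def power_divide power_mult_distrib field_simps power2_eq_square)
    then have "0 = (\<Sum>z\<in>UNIV. l t * c t $ z + 2 * (v t z)\<^sup>2)"
      using sum_c''[OF t] by simp
    also have "\<dots> = l t * 1 + 2 * (\<Sum>z\<in>UNIV. (v t z)\<^sup>2)"
      by (simp only: sum.distrib sum_distrib_left[symmetric] sum1[OF t])
    finally show ?thesis by simp
  qed
  \<comment> \<open>Conservation of energy: each square has derivative
    \<open>l t / 2 * c' t $ z\<close> with a factor independent of z, and the components of
    \<open>c' t\<close> sum to 0.\<close>
  have "((\<lambda>t. \<Sum>z\<in>UNIV. (v t z)\<^sup>2) has_real_derivative 0) (at t within I)" if t: "t \<in> I" for t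
  proof -
    have "((\<lambda>t. (v t z)\<^sup>2) has_real_derivative l t / 2 * c' t $ z) (at t)" for z
    proof -
      have "2 * v t z * sqrt (c t $ z) = c' t $ z"
        using pos[OF t, of z] by (simp add: v_def)
      then have "2 * v t z * (l t / 2 * sqrt (c t $ z)) = l t / 2 * c' t $ z"
        by (metis mult.assoc mult.left_commute)
      moreover have "((\<lambda>t. (v t z)\<^sup>2) has_real_derivative
          2 * v t z * (l t / 2 * sqrt (c t $ z))) (at t)"
        using DERIV_power[OF Dv[OF t], of z 2] by (simp add: mult.commute mult.left_commute)
      ultimately show ?thesis by (simp only:)
    qed
    then have "((\<lambda>t. \<Sum>z\<in>UNIV. (v t z)\<^sup>2) has_real_derivative
        (\<Sum>z\<in>UNIV. l t / 2 * c' t $ z)) (at t)"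
      by (intro DERIV_sum) auto
    moreover have "(\<Sum>z\<in>UNIV. l t / 2 * c' t $ z) = 0"
      using sum_c'[OF t] by (simp only: sum_distrib_left[symmetric] mult_zero_right)
    ultimately show ?thesis by (simp add: has_field_derivative_at_within)
  qed
  then obtain e where e: "\<And>t. t \<in> I \<Longrightarrow> (\<Sum>z\<in>UNIV. (v t z)\<^sup>2) = e"
    using has_field_derivative_zero_constant[of I "\<lambda>t. \<Sum>z\<in>UNIV. (v t z)\<^sup>2"] I(2)
    by (auto simp: is_interval_convex_1)
  have v_eq: "v t z = vector_derivative c (at t) $ z / (2 * sqrt (c t $ z))" if "t \<in> I" for t z
    using vector_derivative_at[OF D1[OF that]] by (simp add: v_def)
  show thesis
  \<comment> \<open>For empty \<open>I\<close> the constant \<open>e\<close> may be negative; the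
    absolute value covers this case. If \<open>I\<close> has a point, \<open>e\<close> is a sum of
    squares and nothing changes.\<close>
  proof (rule that[of "\<bar>e\<bar>"])
    fix t z assume t: "t \<in> I"
    show "((\<lambda>t. sqrt (c t $ z)) has_real_derivative
        vector_derivative c (at t) $ z / (2 * sqrt (c t $ z))) (at t)"
      using Dx[OF t] v_eq[OF t] by simp
    have "0 \<le> e" using e[OF t] by (metis sum_nonneg zero_le_power2)
    then have "((\<lambda>t. v t z) has_real_derivative - \<bar>e\<bar> * sqrt (c t $ z)) (at t)"
      using Dv[OF t, of z] l_eq[OF t] e[OF t] by simp
    then show "((\<lambda>t. vector_derivative c (at t) $ z / (2 * sqrt (c t $ z)))
        has_real_derivative - \<bar>e\<bar> * sqrt (c t $ z)) (at t)"
      by (rule has_field_derivative_transform_within_open[OF _ I(1) t]) (rule v_eq)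
  qed simp
qed

text \<open>The energy \<open>(y' t)\<^sup>2 + e * (y t)\<^sup>2\<close> is constant, hence 0.
  Reading off \<open>y' t = 0\<close>, and then that \<open>y\<close> is constant, also covers
  \<open>e = 0\<close>.\<close>

lemma harmonic_oscillator_zero:
  fixes y y' :: "real \<Rightarrow> real"
  assumes I: "is_interval I" and e: "e \<ge> 0" and t0: "t0 \<in> I" "y t0 = 0" "y' t0 = 0"
    and D1: "\<And>t. t \<in> I \<Longrightarrow> (y has_real_derivative y' t) (at t)"
    and D2: "\<And>t. t \<in> I \<Longrightarrow> (y' has_real_derivative - e * y t) (at t)"
    and t: "t \<in> I"
  shows "y t = 0"
proof -
  have cv: "convex I" using I by (simp add: is_interval_convex_1)
  have "((\<lambda>t. (y' t)\<^sup>2 + e * (y t)\<^sup>2) has_real_derivative 0) (at t within I)" if "t \<in> I" for t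
    by (rule has_field_derivative_at_within)
      (auto intro!: derivative_eq_intros D1 D2 that)
  then obtain k where k: "\<And>t. t \<in> I \<Longrightarrow> (y' t)\<^sup>2 + e * (y t)\<^sup>2 = k"
    using has_field_derivative_zero_constant[OF cv, of "\<lambda>t. (y' t)\<^sup>2 + e * (y t)\<^sup>2"] by auto
  have "(y' t)\<^sup>2 + e * (y t)\<^sup>2 = 0" if "t \<in> I" for t
    using k[OF t0(1)] k[OF that] t0(2,3) by simp
  then have "y' t = 0" if "t \<in> I" for t
    using e that add_nonneg_eq_0_iff[of "(y' t)\<^sup>2" "e * (y t)\<^sup>2"] by simp
  then have "(y has_real_derivative 0) (at t within I)" if "t \<in> I" for t
    using D1[OF that] that by (simp add: has_field_derivative_at_within)
  then obtain k where "\<And>t. t \<in> I \<Longrightarrow> y t = k"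
    using has_field_derivative_zero_constant[OF cv, of y] by auto
  then show ?thesis using t t0 by metis
qed

section \<open>The balanced subspace\<close>

text \<open>The counterpart of \<open>L_space\<close> for \<pi> instead of its square root: squaring
  the coordinates turns the quarter powers of the weights into square roots.\<close>

definition balanced_space :: "('z::finite \<Rightarrow> 'z) \<Rightarrow> ('z \<Rightarrow> real) \<Rightarrow> (real ^ 'z) set" where
  "balanced_space \<sigma> \<kappa> = {\<pi>. \<forall>z. sqrt (\<kappa> z) * \<pi> $ z = sqrt (\<kappa> (\<sigma> z)) * \<pi> $ \<sigma> z}"

lemma subspace_balanced_space: "subspace (balanced_space \<sigma> \<kappa>)"
  unfolding subspace_def balanced_space_def by (auto simp: algebra_simps)

lemma subspace_L_space: "subspace (L_space \<sigma> \<kappa>)"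
  unfolding subspace_def L_space_def by (auto simp: algebra_simps)

text \<open>At fixed points of \<sigma> the equation is trivial.\<close>

lemma L_space_alt: "L_space \<sigma> \<kappa> =
    {x. \<forall>z. \<kappa> z powr (1/4) * x $ z = \<kappa> (\<sigma> z) powr (1/4) * x $ \<sigma> z}"
  unfolding L_space_def by (auto, metis)

lemma sqrt_eq_powr_quarter_square: "0 < k \<Longrightarrow> sqrt k = (k powr (1/4))\<^sup>2"
  by (simp add: powr_half_sqrt[symmetric] powr_powr powr_numeral[symmetric] del: powr_numeral)

text \<open>\<open>\<Phi>\<close> is not linear, so dimensions are compared through the diagonal
  automorphism with entries \<open>\<kappa> z powr (1/4)\<close>. A second factor of this kind turns
  the quarter power into \<open>sqrt (\<kappa> z)\<close>.\<close>

lemma dim_L_space: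
  fixes \<kappa> :: "'z::finite \<Rightarrow> real"
  assumes \<kappa>: "\<And>z. 0 < \<kappa> z"
  shows "dim (L_space \<sigma> \<kappa>) = dim (balanced_space \<sigma> \<kappa>)"
proof -
  let ?T = "\<lambda>x :: real ^ 'z. \<chi> z. \<kappa> z powr (1/4) * x $ z"
  let ?R = "\<lambda>x :: real ^ 'z. \<chi> z. x $ z / \<kappa> z powr (1/4)"
  have lin: "linear ?T"
    by (intro linearI) (simp_all add: vec_eq_iff algebra_simps)
  have inv: "?T (?R x) = x" "?R (?T x) = x" for x
    using \<kappa> by (auto simp: vec_eq_iff order_less_imp_not_eq2)
  have iff: "?T x \<in> L_space \<sigma> \<kappa> \<longleftrightarrow> x \<in> balanced_space \<sigma> \<kappa>" for x
    unfolding L_space_alt balanced_space_def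
    by (simp add: sqrt_eq_powr_quarter_square[OF \<kappa>] power2_eq_square mult.assoc)
  have "?T ` balanced_space \<sigma> \<kappa> = L_space \<sigma> \<kappa>"
  proof
    show "L_space \<sigma> \<kappa> \<subseteq> ?T ` balanced_space \<sigma> \<kappa>"
    proof
      fix x assume "x \<in> L_space \<sigma> \<kappa>"
      then have "?R x \<in> balanced_space \<sigma> \<kappa>"
        by (subst iff[symmetric]) (simp only: inv(1))
      then show "x \<in> ?T ` balanced_space \<sigma> \<kappa>"
        by (rule image_eqI[where f = ?T and x = "?R x", OF inv(1)[of x, symmetric]])
    qed
  qed (use iff in blast)
  moreover have "inj ?T" by (rule inj_on_inverseI[where g = ?R]) (rule inv(2))
  then have "dim (?T ` balanced_space \<sigma> \<kappa>) = dim (balanced_space \<sigma> \<kappa>)"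
    using dim_image_eq[OF lin] inj_on_subset[OF _ subset_UNIV] by blast
  ultimately show ?thesis by simp
qed

text \<open>Both sides of each equation for \<open>L_space\<close> are nonnegative, so squaring them
  is an equivalence; the factor 2 in \<open>\<Phi>\<close> cancels.\<close>

lemma Phi_mem_L_space_iff:
  fixes \<pi> :: "real ^ 'z::finite"
  assumes \<kappa>: "\<And>z. 0 < \<kappa> z" and \<pi>: "\<And>z. 0 < \<pi> $ z"
  shows "\<Phi> \<pi> \<in> L_space \<sigma> \<kappa> \<longleftrightarrow> \<pi> \<in> balanced_space \<sigma> \<kappa>"
proof -
  have sq: "sqrt (\<kappa> i) * \<pi> $ i = (\<kappa> i powr (1/4) * sqrt (\<pi> $ i))\<^sup>2" for i
    using \<pi>[of i] by (simp add: sqrt_eq_powr_quarter_square[OF \<kappa>] power_mult_distrib)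
  have nn: "0 \<le> \<kappa> i powr (1/4) * sqrt (\<pi> $ i)" for i
    using \<pi>[of i] by simp
  have "sqrt (\<kappa> i) * \<pi> $ i = sqrt (\<kappa> j) * \<pi> $ j \<longleftrightarrow>
      \<kappa> i powr (1/4) * sqrt (\<pi> $ i) = \<kappa> j powr (1/4) * sqrt (\<pi> $ j)" for i j
    unfolding sq by (rule power2_eq_iff_nonneg[OF nn nn])
  then show ?thesis
    by (simp add: L_space_alt balanced_space_def \<Phi>_def)
qed

lemma Phi_image_open_simplex: "\<Phi> ` open_simplex = (pos_sphere :: (real ^ 'z::finite) set)"
proof
  show "\<Phi> ` open_simplex \<subseteq> (pos_sphere :: (real ^ 'z) set)"
    by (auto simp: \<Phi>_def pos_sphere_def open_simplex_iff inner_one_vec power_mult_distrib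
        less_imp_le sum_distrib_left[symmetric])
  show "pos_sphere \<subseteq> \<Phi> ` (open_simplex :: (real ^ 'z) set)"
  proof
    fix x :: "real ^ 'z" assume x: "x \<in> pos_sphere"
    \<comment> \<open>The inverse of \<open>\<Phi>\<close>; division by 4 normalises the squares on
      the sphere of radius 2.\<close>
    let ?p = "\<chi> z. (x $ z)\<^sup>2 / 4"
    have "?p \<in> open_simplex"
      using x by (auto simp: pos_sphere_def open_simplex_iff inner_one_vec
          sum_divide_distrib[symmetric] order_less_imp_not_eq2)
    moreover have "\<Phi> ?p = x"
      using x by (auto simp: pos_sphere_def \<Phi>_def vec_eq_iff real_sqrt_divide less_imp_le)
    ultimately show "x \<in> \<Phi> ` open_simplex" by (metis image_eqI)
  qed
qed

text \<open>The normalised vector of the \<open>1 / sqrt (\<kappa> z)\<close> works, since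
  \<open>sqrt (\<kappa> z)\<close> times its z-th component does not depend on z. Such a point shows
  that the separatrix is nonempty and that the coordinate sum does not vanish on the balanced
  subspace.\<close>

lemma balanced_space_meets_open_simplex:
  fixes \<kappa> :: "'z::finite \<Rightarrow> real"
  assumes \<kappa>: "\<And>z. 0 < \<kappa> z"
  obtains p where "p \<in> balanced_space \<sigma> \<kappa>" "p \<in> open_simplex"
proof -
  define S where "S = (\<Sum>z\<in>UNIV. 1 / sqrt (\<kappa> z))"
  have S: "S > 0" unfolding S_def using \<kappa> by (intro sum_pos) auto
  let ?p = "\<chi> z. 1 / sqrt (\<kappa> z) / S"
  have "sqrt (\<kappa> z) \<noteq> 0" for z using \<kappa>[of z] by simp
  then have "?p \<in> balanced_space \<sigma> \<kappa>" by (simp add: balanced_space_def)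
  moreover have "(\<Sum>z\<in>UNIV. 1 / sqrt (\<kappa> z) / S) = 1"
    using S by (simp only: sum_divide_distrib[symmetric] S_def[symmetric]) simp
  then have "?p \<in> open_simplex"
    using S \<kappa> by (simp add: open_simplex_iff inner_one_vec)
  ultimately show thesis by (rule that)
qed

section \<open>Geodesics tangent to the balanced subspace\<close>

lemma tangent_space_balanced:
  assumes S: "S \<subseteq> balanced_space \<sigma> \<kappa>" and v: "v \<in> tangent_space S p"
  shows "v \<in> balanced_space \<sigma> \<kappa>"
proof -
  obtain c \<epsilon> where \<epsilon>: "\<epsilon> > 0" "\<And>t. \<bar>t\<bar> < \<epsilon> \<Longrightarrow> c t \<in> S" and c: "(c has_vector_derivative v) (at 0)"
    using v unfolding tangent_space_def by blast
  have "sqrt (\<kappa> z) * v $ z - sqrt (\<kappa> (\<sigma> z)) * v $ \<sigma> z = 0" for z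
  proof (rule DERIV_locally_constant)
    show "((\<lambda>t. sqrt (\<kappa> z) * c t $ z - sqrt (\<kappa> (\<sigma> z)) * c t $ \<sigma> z) has_real_derivative
        sqrt (\<kappa> z) * v $ z - sqrt (\<kappa> (\<sigma> z)) * v $ \<sigma> z) (at 0)"
      by (intro DERIV_diff DERIV_cmult has_real_derivative_vec_nth[OF c])
    show "sqrt (\<kappa> z) * c t $ z - sqrt (\<kappa> (\<sigma> z)) * c t $ \<sigma> z = 0" if "t \<in> ball 0 \<epsilon>" for t
      using \<epsilon>(2)[of t] S that by (auto simp: balanced_space_def)
  qed (use \<epsilon>(1) in auto)
  then show ?thesis by (simp add: balanced_space_def)
qed

text \<open>All components of \<open>sqrt c\<close> satisfy the oscillator equation with the same
  \<open>e\<close>, so the linear forms that define \<open>L_space\<close> do too. Each of them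
  vanishes at \<open>t0\<close> together with its derivative.\<close>

lemma fisher_rao_geodesic_stays_balanced:
  fixes c :: "real \<Rightarrow> real ^ 'z::finite"
  assumes \<kappa>: "\<And>z. 0 < \<kappa> z" and geo: "geodesic_on open_simplex fisher_rao I c"
    and t0: "t0 \<in> I" "c t0 \<in> balanced_space \<sigma> \<kappa>"
      "vector_derivative c (at t0) \<in> balanced_space \<sigma> \<kappa>"
    and t: "t \<in> I"
  shows "c t \<in> balanced_space \<sigma> \<kappa>"
proof -
  have I: "is_interval I" and pos: "\<And>t z. t \<in> I \<Longrightarrow> 0 < c t $ z"
    using geo by (auto simp: geodesic_on_def open_simplex_iff image_subset_iff)
  obtain e where e: "e \<ge> 0" and
    D: "\<And>t z. t \<in> I \<Longrightarrow> ((\<lambda>t. sqrt (c t $ z)) has_real_derivative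
        vector_derivative c (at t) $ z / (2 * sqrt (c t $ z))) (at t)"
    "\<And>t z. t \<in> I \<Longrightarrow> ((\<lambda>t. vector_derivative c (at t) $ z / (2 * sqrt (c t $ z)))
        has_real_derivative - e * sqrt (c t $ z)) (at t)"
    using fisher_rao_geodesic_sqrt[OF geo] by blast
  have mem: "c s \<in> balanced_space \<sigma> \<kappa> \<longleftrightarrow>
      (\<forall>z. \<kappa> z powr (1/4) * sqrt (c s $ z) = \<kappa> (\<sigma> z) powr (1/4) * sqrt (c s $ \<sigma> z))"
    if "s \<in> I" for s
    using Phi_mem_L_space_iff[of \<kappa> "c s" \<sigma>] \<kappa> pos[OF that] by (simp add: L_space_alt \<Phi>_def)
  let ?k = "\<lambda>z. \<kappa> z powr (1/4)" and ?v = "\<lambda>t z. vector_derivative c (at t) $ z / (2 * sqrt (c t $ z))"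
  have "?k z * sqrt (c t $ z) - ?k (\<sigma> z) * sqrt (c t $ \<sigma> z) = 0" for z
  proof (rule harmonic_oscillator_zero[OF I e t0(1) _ _ _ _ t])
    have eq: "?k z * sqrt (c t0 $ z) = ?k (\<sigma> z) * sqrt (c t0 $ \<sigma> z)"
      using mem[OF t0(1)] t0(2) by blast
    then show "?k z * sqrt (c t0 $ z) - ?k (\<sigma> z) * sqrt (c t0 $ \<sigma> z) = 0" by simp
    \<comment> \<open>In this form the numerators at z and \<open>\<sigma> z\<close> agree by the
      condition on the velocity, and the denominators by \<open>eq\<close>.\<close>
    have kv: "?k i * ?v t0 i = sqrt (\<kappa> i) * vector_derivative c (at t0) $ i
        / (2 * (?k i * sqrt (c t0 $ i)))" for i
      using \<kappa>[of i] pos[OF t0(1), of i]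
      by (simp add: sqrt_eq_powr_quarter_square power2_eq_square)
    show "?k z * ?v t0 z - ?k (\<sigma> z) * ?v t0 (\<sigma> z) = 0"
      using t0(3) eq unfolding kv by (simp add: balanced_space_def)
  next
    fix s assume s: "s \<in> I"
    show "((\<lambda>t. ?k z * sqrt (c t $ z) - ?k (\<sigma> z) * sqrt (c t $ \<sigma> z)) has_real_derivative
        ?k z * ?v s z - ?k (\<sigma> z) * ?v s (\<sigma> z)) (at s)"
      by (intro DERIV_diff DERIV_cmult D(1) s)
    have "((\<lambda>t. ?k z * ?v t z - ?k (\<sigma> z) * ?v t (\<sigma> z)) has_real_derivative
        ?k z * (- e * sqrt (c s $ z)) - ?k (\<sigma> z) * (- e * sqrt (c s $ \<sigma> z))) (at s)"
      by (intro DERIV_diff DERIV_cmult D(2) s)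
    then show "((\<lambda>t. ?k z * ?v t z - ?k (\<sigma> z) * ?v t (\<sigma> z)) has_real_derivative
        - e * (?k z * sqrt (c s $ z) - ?k (\<sigma> z) * sqrt (c s $ \<sigma> z))) (at s)"
      by (rule DERIV_cong) (simp add: algebra_simps)
  qed
  then show ?thesis using mem[OF t] by simp
qed

section \<open>The separatrix\<close>

context spectral_duality_structure
begin

text \<open>The relation is a combination of the functions \<open>f \<nu>\<close> with coefficients
  \<open>A *v w\<close>. Their independence makes these vanish, and full column rank makes
  \<open>A\<close> injective.\<close>

lemma u_spec_independent:
  assumes "\<And>\<gamma>. \<gamma> \<in> {0<..<1} \<Longrightarrow> (\<Sum>z\<in>UNIV. w z * u_spec f A z \<gamma>) = 0"
  shows "w z = 0"
proof -
  let ?w = "\<chi> z. w z"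
  have "(\<Sum>\<nu>\<in>UNIV. (A *v ?w) $ \<nu> * f \<nu> \<gamma>) = (\<Sum>z\<in>UNIV. w z * u_spec f A z \<gamma>)" for \<gamma>
    unfolding u_spec_def matrix_vector_mult_def sum_distrib_left sum_distrib_right vec_lambda_beta
    by (subst sum.swap) (simp add: ac_simps)
  then have "\<forall>\<nu>. (A *v ?w) $ \<nu> = 0"
    using assms by (intro lin_indep) simp
  then have "A *v ?w = A *v 0" by (simp add: vec_eq_iff)
  then have "?w = 0"
    using full_column_rank full_rank_injective[of A] by (metis injD)
  then show ?thesis by (simp add: vec_eq_iff)
qed

lemma s_spec_eq: "s_spec f A B z \<gamma> = u_spec f A z \<gamma> + \<kappa> z * u_spec f A (\<sigma> z) \<gamma>"
  by (simp add: s_spec_def u_spec_def duality algebra_simps sum.distrib sum_distrib_left)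

lemma sum_involution: "(\<Sum>z\<in>UNIV. g (\<sigma> z)) = (\<Sum>z\<in>UNIV. g z)" for g :: "'z \<Rightarrow> real"
  using sum.reindex_bij_betw[of \<sigma> UNIV UNIV g] involution
  by (simp add: involuntory_imp_bij)

text \<open>Reindexing by \<sigma> moves the involution from the spectral function to \<pi> and the
  weight, so that everything is a combination of the \<open>u_spec f A z\<close>.\<close>

lemma sum_u_minus_c_s:
  "(\<Sum>z\<in>UNIV. \<pi> $ z * (u_spec f A z \<gamma> - c * s_spec f A B z \<gamma>)) =
    (\<Sum>z\<in>UNIV. ((1 - c) * \<pi> $ z - c * \<kappa> (\<sigma> z) * \<pi> $ \<sigma> z) * u_spec f A z \<gamma>)"
proof -
  have "(\<Sum>z\<in>UNIV. c * \<kappa> z * \<pi> $ z * u_spec f A (\<sigma> z) \<gamma>) =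
      (\<Sum>z\<in>UNIV. c * \<kappa> (\<sigma> z) * \<pi> $ \<sigma> z * u_spec f A z \<gamma>)"
    using sum_involution[of "\<lambda>z. c * \<kappa> z * \<pi> $ z * u_spec f A (\<sigma> z) \<gamma>"]
    by (simp add: involution)
  then show ?thesis
    by (simp add: s_spec_eq algebra_simps sum_subtractf sum.distrib)
qed

text \<open>It serves two purposes: with arbitrary \<open>c\<close> for the constancy of
  \<open>C \<pi>\<close>, and with \<open>c = C_star K\<close> for orthogonality to the response
  vectors.\<close>

lemma sum_u_minus_c_s_zero_iff:
  "(\<forall>\<gamma>\<in>{0<..<1}. (\<Sum>z\<in>UNIV. \<pi> $ z * (u_spec f A z \<gamma> - c * s_spec f A B z \<gamma>)) = 0) \<longleftrightarrow>
    (\<forall>z. (1 - c) * \<pi> $ z = c * \<kappa> (\<sigma> z) * \<pi> $ \<sigma> z)"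
  unfolding sum_u_minus_c_s
  using u_spec_independent[of "\<lambda>z. (1 - c) * \<pi> $ z - c * \<kappa> (\<sigma> z) * \<pi> $ \<sigma> z"] by auto

lemma C_eq_iff:
  assumes "\<pi> \<in> prob_simplex"
  shows "(\<forall>\<gamma>\<in>{0<..<1}. C \<pi> \<gamma> = c) \<longleftrightarrow> (\<forall>z. (1 - c) * \<pi> $ z = c * \<kappa> (\<sigma> z) * \<pi> $ \<sigma> z)"
proof -
  have "C \<pi> \<gamma> = c \<longleftrightarrow> (\<Sum>z\<in>UNIV. \<pi> $ z * (u_spec f A z \<gamma> - c * s_spec f A B z \<gamma>)) = 0"
    if "\<gamma> \<in> {0<..<1}" for \<gamma>
  proof -
    have "(\<Sum>z\<in>UNIV. \<pi> $ z * (u_spec f A z \<gamma> - c * s_spec f A B z \<gamma>)) =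
        (\<Sum>z\<in>UNIV. \<pi> $ z * u_spec f A z \<gamma>) - c * (\<Sum>z\<in>UNIV. \<pi> $ z * s_spec f A B z \<gamma>)"
      by (simp add: right_diff_distrib sum_subtractf sum_distrib_left mult.left_commute)
    then show ?thesis
      using denominator_pos[OF assms that] representation[OF assms that] by (simp add: divide_eq_eq)
  qed
  then show ?thesis using sum_u_minus_c_s_zero_iff by simp
qed

text \<open>The ratio of \<open>1 - C_star K\<close> to \<open>C_star K\<close> is
  \<open>sqrt K\<close>, which is \<open>sqrt (\<kappa> z) * sqrt (\<kappa> (\<sigma> z))\<close>;
  the second factor cancels.\<close>

lemma balanced_iff_C_star:
  "\<pi> \<in> balanced_space \<sigma> \<kappa> \<longleftrightarrow>
    (\<forall>z. (1 - C_star K) * \<pi> $ z = C_star K * \<kappa> (\<sigma> z) * \<pi> $ \<sigma> z)"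
proof -
  have K1: "1 + sqrt K > 0" using K_pos by (simp add: add_pos_pos)
  have "(1 - C_star K) * x = C_star K * \<kappa> (\<sigma> z) * y \<longleftrightarrow> sqrt (\<kappa> z) * x = sqrt (\<kappa> (\<sigma> z)) * y" for z x y
  proof -
    have "(1 - C_star K) * x = C_star K * \<kappa> (\<sigma> z) * y \<longleftrightarrow> sqrt K * x = \<kappa> (\<sigma> z) * y"
      using K1 by (simp add: C_star_def field_simps)
    also have "sqrt K * x = sqrt (\<kappa> (\<sigma> z)) * (sqrt (\<kappa> z) * x)"
      by (simp add: weight_product[of z, symmetric] real_sqrt_mult)
    also have "\<kappa> (\<sigma> z) * y = sqrt (\<kappa> (\<sigma> z)) * (sqrt (\<kappa> (\<sigma> z)) * y)"
      using weight_pos[of "\<sigma> z"] by (simp add: mult.assoc[symmetric])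
    also have "sqrt (\<kappa> (\<sigma> z)) * (sqrt (\<kappa> z) * x) = \<dots> \<longleftrightarrow> sqrt (\<kappa> z) * x = sqrt (\<kappa> (\<sigma> z)) * y"
      using weight_pos[of "\<sigma> z"] by (simp only: mult_cancel_left) simp
    finally show ?thesis .
  qed
  then show ?thesis by (simp add: balanced_space_def)
qed

text \<open>Inserting the relation at \<open>\<sigma> z\<close> into the one at z gives
  \<open>(1 - c)\<^sup>2 = c\<^sup>2 * K\<close>; signs then select the root.\<close>

lemma constant_value_C_star:
  assumes pos: "\<And>z. 0 < \<pi> $ z"
    and rel: "\<And>z. (1 - c) * \<pi> $ z = c * \<kappa> (\<sigma> z) * \<pi> $ \<sigma> z"
  shows "c = C_star K"
proof -
  fix z :: 'z
  have "(1 - c) * ((1 - c) * \<pi> $ z) = c * \<kappa> (\<sigma> z) * ((1 - c) * \<pi> $ \<sigma> z)"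
    unfolding rel[of z] by simp
  also have "\<dots> = c * c * (\<kappa> z * \<kappa> (\<sigma> z)) * \<pi> $ z"
    unfolding rel[of "\<sigma> z"] involution by simp
  finally have "((1 - c)\<^sup>2 - c\<^sup>2 * K) * \<pi> $ z = 0"
    unfolding weight_product by (simp add: power2_eq_square algebra_simps)
  then have "(1 - c)\<^sup>2 = (c * sqrt K)\<^sup>2"
    using pos[of z] K_pos by (simp add: power_mult_distrib)
  moreover have a: "0 < \<kappa> (\<sigma> z) * \<pi> $ \<sigma> z" using pos weight_pos by simp
  \<comment> \<open>Together with \<open>0 \<le> 1 - c\<close> below, this excludes the root with
    \<open>1 - c = - c * sqrt K\<close>.\<close>
  have c: "c > 0"
  proof (rule ccontr)
    assume "\<not> c > 0"
    then have "0 < (1 - c) * \<pi> $ z" "c * (\<kappa> (\<sigma> z) * \<pi> $ \<sigma> z) \<le> 0"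
      using pos[of z] a by (auto intro: mult_nonpos_nonneg)
    then show False using rel[of z] by (simp add: mult.assoc)
  qed
  then have "0 < (1 - c) * \<pi> $ z"
    using rel[of z] a by (simp add: mult.assoc)
  then have "0 \<le> 1 - c"
    using pos[of z] by (simp add: zero_less_mult_iff)
  ultimately have "1 - c = c * sqrt K"
    using K_pos c power2_eq_imp_eq[of "1 - c" "c * sqrt K"] by simp
  then have "c * (1 + sqrt K) = 1" by (simp add: algebra_simps)
  moreover have "1 + sqrt K \<noteq> 0" using K_pos by (smt (verit) real_sqrt_gt_zero)
  ultimately show ?thesis by (simp add: C_star_def eq_divide_eq)
qed

lemma open_separatrix_eq: "open_separatrix C = balanced_space \<sigma> \<kappa> \<inter> open_simplex"
proof (intro set_eqI)
  fix \<pi> :: "real ^ 'z"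
  show "\<pi> \<in> open_separatrix C \<longleftrightarrow> \<pi> \<in> balanced_space \<sigma> \<kappa> \<inter> open_simplex"
  proof (cases "\<pi> \<in> open_simplex")
    case True
    then have ps: "\<pi> \<in> prob_simplex" and pos: "\<And>z. 0 < \<pi> $ z"
      by (auto simp: open_simplex_def)
    have "C \<pi> constant_on {0<..<1} \<longleftrightarrow> (\<exists>c. \<forall>z. (1 - c) * \<pi> $ z = c * \<kappa> (\<sigma> z) * \<pi> $ \<sigma> z)"
      unfolding constant_on_def C_eq_iff[OF ps] ..
    also have "\<dots> \<longleftrightarrow> \<pi> \<in> balanced_space \<sigma> \<kappa>"
      unfolding balanced_iff_C_star using constant_value_C_star[OF pos] by blast
    finally show ?thesis
      using True ps by (auto simp: open_separatrix_def separatrix_def)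
  qed (simp add: open_separatrix_def)
qed

text \<open>The sum in \<open>sum_u_minus_c_s_zero_iff\<close> for \<open>c = C_star K\<close> is
  the inner product of \<pi> with \<open>psi f A B K \<gamma>\<close>. The balanced subspace is thus
  the orthogonal complement of the span of the response vectors.\<close>

lemma dim_balanced_space: "dim (balanced_space \<sigma> \<kappa>) + response_dim f A B K = CARD('z)"
proof -
  let ?V = "span (psi f A B K ` {0<..<1})"
  have "\<pi> \<in> balanced_space \<sigma> \<kappa> \<longleftrightarrow> (\<forall>x\<in>?V. orthogonal x \<pi>)" for \<pi>
  proof -
    have "(\<forall>x\<in>?V. orthogonal x \<pi>) \<longleftrightarrow> (\<forall>\<gamma>\<in>{0<..<1}. orthogonal \<pi> (psi f A B K \<gamma>))"
    proof (intro iffI ballI)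
      fix \<gamma> :: real assume "\<forall>x\<in>?V. orthogonal x \<pi>" "\<gamma> \<in> {0<..<1}"
      then show "orthogonal \<pi> (psi f A B K \<gamma>)"
        using span_base[of "psi f A B K \<gamma>"] by (subst orthogonal_commute) blast
    next
      fix x assume h: "\<forall>\<gamma>\<in>{0<..<1}. orthogonal \<pi> (psi f A B K \<gamma>)" and x: "x \<in> ?V"
      show "orthogonal x \<pi>"
        by (subst orthogonal_commute, rule orthogonal_to_span[OF x]) (use h in blast)
    qed
    also have "\<dots> \<longleftrightarrow> \<pi> \<in> balanced_space \<sigma> \<kappa>"
      unfolding balanced_iff_C_star sum_u_minus_c_s_zero_iff[symmetric]
      by (simp add: orthogonal_def inner_vec_def psi_def)
    finally show ?thesis ..
  qed
  then have "balanced_space \<sigma> \<kappa> = {y \<in> UNIV. \<forall>x\<in>?V. orthogonal x y}" by auto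
  then show ?thesis
    using dim_subspace_orthogonal_to_vectors[of ?V UNIV] by (simp add: response_dim_def)
qed

section \<open>Total geodesy of the open separatrix\<close>

lemma totally_geodesic_open_separatrix:
  "totally_geodesic_submanifold open_simplex fisher_rao
    (dim (balanced_space \<sigma> \<kappa>) - 1) (open_separatrix C)"
  unfolding totally_geodesic_submanifold_def
proof (intro conjI openin_affine_hull_open_simplex allI impI)
  \<comment> \<open>The direction space of the separatrix: differences of points of the simplex have
    coordinate sum 0, which costs one dimension.\<close>
  let ?H = "{x \<in> balanced_space \<sigma> \<kappa>. 1 \<bullet> x = 0}"
  obtain p where p: "p \<in> balanced_space \<sigma> \<kappa>" "p \<in> open_simplex"
    using balanced_space_meets_open_simplex weight_pos by blast
  have "embedded_submanifold (dim ?H) (open_separatrix C)"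
  proof (rule embedded_submanifold_affine_slice[OF _ open_positive_orthant])
    show "subspace ?H"
      using subspace_inter[OF subspace_balanced_space subspace_hyperplane[of 1]]
      by (simp add: Int_def)
    fix p x assume p: "p \<in> open_separatrix C" and x: "x \<in> {x :: real ^ 'z. \<forall>z. 0 < x $ z}"
    have "x \<in> balanced_space \<sigma> \<kappa> \<longleftrightarrow> x - p \<in> balanced_space \<sigma> \<kappa>"
      using p subspace_balanced_space[of \<sigma> \<kappa>] unfolding open_separatrix_eq
      by (metis IntD1 diff_add_cancel subspace_add subspace_diff)
    then show "x \<in> open_separatrix C \<longleftrightarrow> x - p \<in> ?H"
      using p x by (auto simp: open_separatrix_eq open_simplex_iff inner_diff_right)
  qed (auto simp: open_separatrix_eq open_simplex_iff)
  moreover have "dim ?H + 1 = dim (balanced_space \<sigma> \<kappa>)"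
    using p by (intro dim_subspace_Int_hyperplane subspace_balanced_space) (auto simp: open_simplex_iff)
  then have "dim ?H = dim (balanced_space \<sigma> \<kappa>) - 1" by simp
  ultimately show "embedded_submanifold (dim (balanced_space \<sigma> \<kappa>) - 1) (open_separatrix C)"
    by simp
next
  show "open_separatrix C \<subseteq> open_simplex" by (simp add: open_separatrix_def)
next
  fix I c t0
  assume h: "geodesic_on open_simplex fisher_rao I c \<and> t0 \<in> I \<and> c t0 \<in> open_separatrix C \<and>
      vector_derivative c (at t0) \<in> tangent_space (open_separatrix C) (c t0)"
  have v: "vector_derivative c (at t0) \<in> balanced_space \<sigma> \<kappa>"
    using tangent_space_balanced h open_separatrix_eq by blast
  have g: "geodesic_on open_simplex fisher_rao I c" "t0 \<in> I" "c t0 \<in> balanced_space \<sigma> \<kappa>"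
    using h by (simp_all add: open_separatrix_eq)
  have "c t \<in> balanced_space \<sigma> \<kappa>" if "t \<in> I" for t
    by (rule fisher_rao_geodesic_stays_balanced[where \<kappa> = \<kappa>, OF weight_pos g v that])
  moreover have "c t \<in> open_simplex" if "t \<in> I" for t
    using h that by (auto simp: geodesic_on_def)
  ultimately have "c t \<in> open_separatrix C" if "t \<in> I" for t
    using that by (simp add: open_separatrix_eq)
  then show "\<exists>\<epsilon>>0. \<forall>t\<in>I. \<bar>t - t0\<bar> < \<epsilon> \<longrightarrow> c t \<in> open_separatrix C"
    \<comment> \<open>The geodesic stays in the separatrix on all of \<open>I\<close>, so any
      positive radius will do.\<close>
    by (intro exI[of _ 1]) auto
qed

end

section \<open>Great subsphere and codimension count\<close>

theorem theorem5p4: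
  fixes C :: "real ^ 'z::finite \<Rightarrow> real \<Rightarrow> real"
    and f :: "'n::finite \<Rightarrow> real \<Rightarrow> real"
    and A B :: "real ^ 'z ^ 'n"
    and \<sigma> :: "'z \<Rightarrow> 'z"
    and \<kappa> :: "'z \<Rightarrow> real"
    and K :: real
    and r :: nat
  assumes "spectral_duality_structure C f A B \<sigma> \<kappa> K"
    and "r = response_dim f A B K"
  shows "subspace (L_space \<sigma> \<kappa>) \<and> int (dim (L_space \<sigma> \<kappa>)) = int CARD('z) - int r
    \<and> \<Phi> ` open_separatrix C = L_space \<sigma> \<kappa> \<inter> pos_sphere
    \<and> (\<exists>k G. int k = int CARD('z) - int r - 1 \<and> great_subsphere k G
          \<and> openin (top_of_set G) (\<Phi> ` open_separatrix C) \<and> \<Phi> ` open_separatrix C \<noteq> {})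
    \<and> (\<exists>k. embedded_submanifold (k + r) (open_simplex :: (real ^ 'z) set)
          \<and> totally_geodesic_submanifold open_simplex fisher_rao k (open_separatrix C))"
proof -
  interpret spectral_duality_structure C f A B \<sigma> \<kappa> K by fact
  let ?W = "balanced_space \<sigma> \<kappa>" and ?L = "L_space \<sigma> \<kappa>"
  have dims: "dim ?L = dim ?W" "dim ?W + r = CARD('z)"
    using dim_L_space weight_pos dim_balanced_space assms(2) by auto
  obtain p where p: "p \<in> ?W" "p \<in> open_simplex"
    using balanced_space_meets_open_simplex weight_pos by blast
  have "dim {x \<in> ?W. 1 \<bullet> x = 0} + 1 = dim ?W"
    using p by (intro dim_subspace_Int_hyperplane subspace_balanced_space)
      (auto simp: open_simplex_iff)
  \<comment> \<open>This makes the natural-number subtraction in \<open>dim ?W - 1\<close> a true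
    one.\<close>
  then have W1: "dim ?W \<ge> 1" by simp
  have "\<Phi> x \<in> ?L \<longleftrightarrow> x \<in> ?W" if "x \<in> open_simplex" for x
    using that weight_pos by (intro Phi_mem_L_space_iff) (auto simp: open_simplex_iff)
  then have "\<Phi> ` open_separatrix C = ?L \<inter> \<Phi> ` open_simplex"
    by (auto simp: open_separatrix_eq)
  then have img: "\<Phi> ` open_separatrix C = ?L \<inter> pos_sphere"
    by (simp add: Phi_image_open_simplex)
  have "great_subsphere (dim ?W - 1) (?L \<inter> sphere 0 2)"
    unfolding great_subsphere_def using subspace_L_space dims(1) W1
    by (intro exI[of _ ?L]) auto
  moreover have "pos_sphere = sphere 0 2 \<inter> {x :: real ^ 'z. \<forall>z. 0 < x $ z}"
  proof -
    have "norm x = 2 \<longleftrightarrow> (\<Sum>z\<in>UNIV. (x $ z)\<^sup>2) = 4" for x :: "real ^ 'z"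
      using real_sqrt_eq_iff[of "\<Sum>z\<in>UNIV. (x $ z)\<^sup>2" 4] by (simp add: norm_vec_def L2_set_def)
    then show ?thesis by (auto simp: pos_sphere_def)
  qed
  then have "openin (top_of_set (?L \<inter> sphere 0 2)) (\<Phi> ` open_separatrix C)"
    unfolding img by (metis Int_assoc open_positive_orthant openin_open_Int)
  moreover have "\<Phi> ` open_separatrix C \<noteq> {}"
    using p by (auto simp: open_separatrix_eq)
  moreover have "int (dim ?W - 1) = int CARD('z) - int r - 1"
    using dims W1 by linarith
  \<comment> \<open>Codimension r means that the open simplex has dimension k + r, where k is the
    dimension of the separatrix.\<close>
  moreover have "embedded_submanifold ((dim ?W - 1) + r) (open_simplex :: (real ^ 'z) set)"
    using embedded_submanifold_open_simplex dims W1 by (metis Nat.add_diff_assoc2)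
  moreover have "int (dim ?L) = int CARD('z) - int r" using dims by linarith
  ultimately show ?thesis
    using img subspace_L_space totally_geodesic_open_separatrix by blast
qed

end
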